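(* For every number of agents $n\ge 1$, the strict competitive ratio of any randomized online algorithm for the online max-min fair allocation problem is at most $1/n!$ in the adversarial arrival model.
   Context: Setting (online max-min fair allocation, adversarial arrival). There are agents $N=\{1,\dots,n\}$; a finite sequence $\sigma$ of items, fixed in advance by an oblivious adversary, arrives one by one. On arrival of an item $e$ its value vector $(v_1(e),\dots,v_n(e))\in[0,1]^n$ is revealed, and $e$ must be irrevocably given to one agent; the number of items is not known in advance. Valuations are additive: $v_i(X)=\sum_{e\in X}v_i(e)$. A randomized online algorithm's decision for an item depends only on the value vectors revealed so far (including that of the current item), on its past decisions and on its internal randomness. $\mathrm{ALG}(\sigma)$ is $\min_{i\in N}v_i(A_i)$ for the allocation produced by the algorithm, and $\mathrm{OPT}(\sigma)$ is the maximum of $\min_{i\in N}v_i(A_i)$ over all allocations (partitions of the items into $n$ parts). The strict competitive ratio of $\mathrm{ALG}$ is $\inf_\sigma \mathbb{E}[\mathrm{ALG}(\sigma)]/\mathrm{OPT}(\sigma)$ (over $\sigma$ with $\mathrm{OPT}(\sigma)>0$). *)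

theory Defs
  imports "HOL-Probability.Probability"
begin

text \<open>
  Agents are \<open>1, \<dots>, n\<close>. An item is identified with its arrival index in the sequence, so that several
  items may have the same value vector.
\<close>

type_synonym value_vector = "nat \<Rightarrow> real"

definition value_vectors :: "nat \<Rightarrow> value_vector set" where
  "value_vectors n = ({1..n} \<rightarrow>\<^sub>E {0..1})"

definition instances :: "nat \<Rightarrow> value_vector list set" where
  "instances n = lists (value_vectors n)"

definition valuation :: "value_vector list \<Rightarrow> nat \<Rightarrow> nat set \<Rightarrow> real" where
  "valuation \<sigma> i X = (\<Sum>e\<in>X. (\<sigma> ! e) i)"

text \<open>Parts of an allocation may be empty.\<close>

definition allocations :: "nat \<Rightarrow> value_vector list \<Rightarrow> (nat \<Rightarrow> nat set) set" where
  "allocations n \<sigma> = {A \<in> {1..n} \<rightarrow>\<^sub>E Pow {..<length \<sigma>}.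
     disjoint_family_on A {1..n} \<and> (\<Union>i\<in>{1..n}. A i) = {..<length \<sigma>}}"

definition min_value :: "nat \<Rightarrow> value_vector list \<Rightarrow> (nat \<Rightarrow> nat set) \<Rightarrow> real" where
  "min_value n \<sigma> A = Min ((\<lambda>i. valuation \<sigma> i (A i)) ` {1..n})"

definition opt :: "nat \<Rightarrow> value_vector list \<Rightarrow> real" where
  "opt n \<sigma> = Max (min_value n \<sigma> ` allocations n \<sigma>)"

text \<open>
  The arguments of an algorithm are the outcome of its internal randomness, the value vectors
  revealed so far (the last one being that of the current item), and its past decisions; the result
  is the agent receiving the current item. The internal randomness is an arbitrary probability space.
\<close>

type_synonym 'w algorithm = "'w \<Rightarrow> value_vector list \<Rightarrow> nat list \<Rightarrow> nat"

definition randomized_online_algorithm :: "nat \<Rightarrow> 'w measure \<Rightarrow> 'w algorithm \<Rightarrow> bool" where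
  "randomized_online_algorithm n M alg \<longleftrightarrow> prob_space M \<and>
     (\<forall>vs\<in>instances n. \<forall>ds\<in>lists {1..n}. length vs = Suc (length ds) \<longrightarrow>
        (\<lambda>\<omega>. alg \<omega> vs ds) \<in> measurable M (count_space {1..n}))"

text \<open>The decisions for the first \<open>t\<close> items of \<open>\<sigma>\<close>.\<close>

primrec decisions :: "'w algorithm \<Rightarrow> value_vector list \<Rightarrow> 'w \<Rightarrow> nat \<Rightarrow> nat list" where
  "decisions alg \<sigma> \<omega> 0 = []"
| "decisions alg \<sigma> \<omega> (Suc t) =
     decisions alg \<sigma> \<omega> t @ [alg \<omega> (take (Suc t) \<sigma>) (decisions alg \<sigma> \<omega> t)]"

definition alg_allocation :: "'w algorithm \<Rightarrow> value_vector list \<Rightarrow> 'w \<Rightarrow> nat \<Rightarrow> nat set" where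
  "alg_allocation alg \<sigma> \<omega> i =
     {e. e < length \<sigma> \<and> decisions alg \<sigma> \<omega> (length \<sigma>) ! e = i}"

definition alg_value :: "nat \<Rightarrow> 'w algorithm \<Rightarrow> value_vector list \<Rightarrow> 'w \<Rightarrow> real" where
  "alg_value n alg \<sigma> \<omega> = min_value n \<sigma> (alg_allocation alg \<sigma> \<omega>)"

text \<open>
  For \<open>n \<ge> 1\<close> the infimum is over a nonempty set of nonnegative reals, so \<open>INF\<close> on the reals is the
  true infimum.
\<close>

definition strict_competitive_ratio :: "nat \<Rightarrow> 'w measure \<Rightarrow> 'w algorithm \<Rightarrow> real" where
  "strict_competitive_ratio n M alg =
     (INF \<sigma>\<in>{\<sigma> \<in> instances n. opt n \<sigma> > 0}. (\<integral>\<omega>. alg_value n alg \<sigma> \<omega> \<partial>M) / opt n \<sigma>)"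

end

theory Submission imports Defs begin

text \<open>
  For a permutation \<open>xs\<close> of the agents, let item \<open>t\<close> have value \<open>1\<close> for \<open>xs ! t, xs ! (t + 1), \<dots>\<close> and
  \<open>0\<close> for the other agents. Giving item \<open>t\<close> to agent \<open>xs ! t\<close> shows that the optimum is at least
  \<open>1\<close>, and this is the only allocation of positive minimum value. To find it, the algorithm has to
  guess \<open>xs ! t\<close> knowing \<open>xs ! 0, \<dots>, xs ! (t - 1)\<close> only, so for each outcome of its internal
  randomness it succeeds for at most one of the \<open>n!\<close> permutations. Averaging over the permutations
  yields one whose success probability is at most \<open>1 / n!\<close>.
\<close>

text \<open>The list \<open>ys\<close> collects the agents that have lost interest for good. The
  restriction to \<open>{1..n}\<close> makes the vector extensional, as membership in
  \<open>value_vectors n\<close> demands.\<close>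

definition hard_item :: "nat \<Rightarrow> nat list \<Rightarrow> value_vector" where
  "hard_item n ys = (\<lambda>i\<in>{1..n}. if i \<in> set ys then 0 else 1)"

definition hard_instance :: "nat \<Rightarrow> nat list \<Rightarrow> value_vector list" where
  "hard_instance n xs = map (\<lambda>t. hard_item n (take t xs)) [0..<n]"

lemma length_hard_instance [simp]: "length (hard_instance n xs) = n"
  by (simp add: hard_instance_def)

lemma hard_instance_in_instances: "hard_instance n xs \<in> instances n"
  by (auto simp: hard_instance_def instances_def value_vectors_def hard_item_def)

lemma hard_instance_nth:
  assumes "t < n" "i \<in> {1..n}"
  shows "(hard_instance n xs ! t) i = (if i \<in> set (take t xs) then 0 else 1)"
  using assms by (simp add: hard_instance_def hard_item_def)

text \<open>The off-by-one is the source of hardness: item \<open>t\<close> is built from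
  \<open>take t xs\<close>, so the items up to and including it carry no information about
  \<open>xs ! t\<close>.\<close>

lemma take_hard_instance_cong:
  assumes "take t xs = take t ys"
  shows "take (Suc t) (hard_instance n xs) = take (Suc t) (hard_instance n ys)"
proof -
  have "take s xs = take s ys" if "s \<le> t" for s
    using assms that by (metis min.absorb1 take_take)
  moreover have "s \<le> t" if "s \<in> set (take (Suc t) [0..<n])" for s
    using that by (auto simp: in_set_conv_nth)
  ultimately show ?thesis
    by (auto simp: hard_instance_def take_map)
qed

lemma valuation_nonneg:
  assumes "\<sigma> \<in> instances n" "i \<in> {1..n}" "X \<subseteq> {..<length \<sigma>}"
  shows "valuation \<sigma> i X \<ge> 0"
  unfolding valuation_def
proof (rule sum_nonneg)
  fix e assume "e \<in> X"
  hence "\<sigma> ! e \<in> value_vectors n"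
    using assms unfolding instances_def by (meson in_listsD lessThan_iff nth_mem subsetD)
  thus "(\<sigma> ! e) i \<ge> 0"
    using assms(2) by (auto simp: value_vectors_def PiE_iff)
qed

lemma min_value_le:
  assumes "i \<in> {1..n}"
  shows "min_value n \<sigma> A \<le> valuation \<sigma> i (A i)"
  using assms by (auto simp: min_value_def intro!: Min_le)

lemma min_value_geI:
  assumes "n \<ge> 1" "\<And>i. i \<in> {1..n} \<Longrightarrow> c \<le> valuation \<sigma> i (A i)"
  shows "c \<le> min_value n \<sigma> A"
  using assms by (auto simp: min_value_def)

lemma min_value_le_opt:
  assumes "A \<in> allocations n \<sigma>"
  shows "min_value n \<sigma> A \<le> opt n \<sigma>"
proof -
  have "finite ({1..n} \<rightarrow>\<^sub>E Pow {..<length \<sigma>})"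
    by (intro finite_PiE) auto
  hence "finite (allocations n \<sigma>)"
    unfolding allocations_def by (rule rev_finite_subset) auto
  thus ?thesis
    using assms by (auto simp: opt_def intro!: Max_ge)
qed

lemma alg_value_nonneg:
  assumes "n \<ge> 1" "\<sigma> \<in> instances n"
  shows "alg_value n alg \<sigma> \<omega> \<ge> 0"
  unfolding alg_value_def
  by (intro min_value_geI valuation_nonneg[OF assms(2)] assms(1)) (auto simp: alg_allocation_def)

lemma opt_hard_instance:
  assumes "n \<ge> 1" "xs \<in> permutations_of_set {1..n}"
  shows "opt n (hard_instance n xs) \<ge> 1"
proof -
  have xs: "set xs = {1..n}" "distinct xs" "length xs = n"
    using assms(2) length_finite_permutations_of_set[OF assms(2)]
    by (auto dest: permutations_of_setD)
  define A where "A = (\<lambda>i\<in>{1..n}. {t. t < n \<and> xs ! t = i})"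
  have in_range: "xs ! t \<in> {1..n}" if "t < n" for t
    using that xs nth_mem by blast
  have "A \<in> allocations n (hard_instance n xs)"
    using in_range by (auto simp: allocations_def A_def disjoint_family_on_def)
  moreover have "1 \<le> min_value n (hard_instance n xs) A"
  proof (rule min_value_geI[OF assms(1)])
    fix i assume i: "i \<in> {1..n}"
    then obtain t where t: "t < n" "xs ! t = i"
      using xs by (metis in_set_conv_nth)
    have "A i = {t}"
      using t i xs by (auto simp: A_def nth_eq_iff_index_eq)
    moreover have "i \<notin> set (take t xs)"
      using t xs by (auto simp: in_set_conv_nth nth_eq_iff_index_eq)
    ultimately show "1 \<le> valuation (hard_instance n xs) i (A i)"
      using t i by (simp add: valuation_def hard_instance_nth)
  qed
  ultimately show ?thesis
    using min_value_le_opt by fastforce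
qed

lemma length_decisions [simp]: "length (decisions alg \<sigma> \<omega> t) = t"
  by (induction t) auto

lemma take_decisions: "s \<le> t \<Longrightarrow> take s (decisions alg \<sigma> \<omega> t) = decisions alg \<sigma> \<omega> s"
  by (induction t) (auto simp: le_Suc_eq)

lemma decisions_nth:
  assumes "s < t"
  shows "decisions alg \<sigma> \<omega> t ! s = alg \<omega> (take (Suc s) \<sigma>) (decisions alg \<sigma> \<omega> s)"
proof -
  have "decisions alg \<sigma> \<omega> t ! s = take (Suc s) (decisions alg \<sigma> \<omega> t) ! s"
    by simp
  also have "\<dots> = decisions alg \<sigma> \<omega> (Suc s) ! s"
    using assms by (subst take_decisions) auto
  also have "\<dots> = alg \<omega> (take (Suc s) \<sigma>) (decisions alg \<sigma> \<omega> s)"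
    by (simp add: nth_append)
  finally show ?thesis .
qed

text \<open>Agent \<open>xs ! t\<close> values only the items \<open>0, ..., t\<close>. By strong
  induction the items before \<open>t\<close> went to other agents, so a positive minimum forces
  item \<open>t\<close> to go to this agent.\<close>

lemma decisions_eq_permutation:
  assumes "xs \<in> permutations_of_set {1..n}"
    and "alg_value n alg (hard_instance n xs) \<omega> > 0"
  shows "decisions alg (hard_instance n xs) \<omega> n = xs"
proof -
  have xs: "set xs = {1..n}" "distinct xs" "length xs = n"
    using assms(1) length_finite_permutations_of_set[OF assms(1)]
    by (auto dest: permutations_of_setD)
  define ds where "ds = decisions alg (hard_instance n xs) \<omega> n"
  have "ds ! t = xs ! t" if "t < n" for t
    using that
  proof (induction t rule: less_induct)
    case (less t)
    define i where "i = xs ! t"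
    define X where "X = {e. e < n \<and> ds ! e = i}"
    have i: "i \<in> {1..n}"
      unfolding i_def using less.prems xs nth_mem by blast
    have "X = alg_allocation alg (hard_instance n xs) \<omega> i"
      by (simp add: X_def ds_def alg_allocation_def)
    hence "0 < valuation (hard_instance n xs) i X"
      using less_le_trans[OF assms(2)[unfolded alg_value_def] min_value_le[OF i]] by simp
    then obtain e where e: "e \<in> X" "(hard_instance n xs ! e) i \<noteq> 0"
      unfolding valuation_def by (metis less_irrefl sum.neutral)
    have "e < n" "ds ! e = xs ! t"
      using e by (auto simp: X_def i_def)
    have "i \<notin> set (take e xs)"
      using e(2) i \<open>e < n\<close> by (auto simp: hard_instance_nth split: if_splits)
    \<comment> \<open>For \<open>e > t\<close> the agent \<open>xs ! t\<close> would occur in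
      \<open>take e xs\<close>.\<close>
    hence "e \<le> t"
      using less.prems xs by (metis i_def in_set_conv_nth length_take min_less_iff_conj not_le nth_take)
    \<comment> \<open>For \<open>e < t\<close> the induction hypothesis gives
      \<open>xs ! e = xs ! t\<close>, against distinctness.\<close>
    moreover have "\<not> e < t"
      using less.IH[of e] less.prems xs \<open>ds ! e = xs ! t\<close> by (auto simp: nth_eq_iff_index_eq)
    ultimately show ?case
      using \<open>ds ! e = xs ! t\<close> by (simp add: le_less)
  qed
  thus ?thesis
    using xs by (auto simp: ds_def intro: nth_equalityI)
qed

text \<open>As long as the two permutations agree, the algorithm sees the same items and has made
  the same decisions. Its next decision is therefore the same in both runs, and success makes it the
  next entry of both permutations.\<close>

lemma successful_permutation_unique:
  assumes xs: "xs \<in> permutations_of_set {1..n}"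
    and ys: "ys \<in> permutations_of_set {1..n}"
    and "alg_value n alg (hard_instance n xs) \<omega> > 0"
    and "alg_value n alg (hard_instance n ys) \<omega> > 0"
  shows "xs = ys"
proof -
  have dx: "decisions alg (hard_instance n xs) \<omega> n = xs"
    and dy: "decisions alg (hard_instance n ys) \<omega> n = ys"
    by (rule decisions_eq_permutation; fact)+
  hence len: "length xs = n" "length ys = n"
    by (metis length_decisions)+
  have "take t xs = take t ys" if "t \<le> n" for t
    using that
  proof (induction t)
    case (Suc t)
    \<comment> \<open>By \<open>dx\<close> the past decisions are themselves the prefix
      \<open>take t xs\<close>.\<close>
    have "xs ! t = alg \<omega> (take (Suc t) (hard_instance n xs)) (take t xs)"
      using Suc.prems decisions_nth[of t n] take_decisions[of t n] dx
      by (metis Suc_le_lessD less_imp_le_nat)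
    moreover have "ys ! t = alg \<omega> (take (Suc t) (hard_instance n ys)) (take t ys)"
      using Suc.prems decisions_nth[of t n] take_decisions[of t n] dy
      by (metis Suc_le_lessD less_imp_le_nat)
    ultimately have "xs ! t = ys ! t"
      using Suc take_hard_instance_cong[of t xs ys n] by simp
    thus ?case
      using Suc len by (simp add: take_Suc_conv_app_nth)
  qed simp
  from this[of n] show ?thesis
    using len by simp
qed

text \<open>Agent \<open>xs ! 0\<close> bounds the minimum, since item \<open>0\<close> is the only
  one it values.\<close>

lemma alg_value_hard_instance_le_1:
  assumes "n \<ge> 1" "xs \<in> permutations_of_set {1..n}"
  shows "alg_value n alg (hard_instance n xs) \<omega> \<le> 1"
proof -
  have xs: "set xs = {1..n}" "length xs = n"
    using assms(2) length_finite_permutations_of_set[OF assms(2)]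
    by (auto dest: permutations_of_setD)
  define i where "i = xs ! 0"
  define X where "X = alg_allocation alg (hard_instance n xs) \<omega> i"
  have i: "i \<in> {1..n}"
    unfolding i_def using assms(1) xs nth_mem[of 0 xs] by auto
  have X: "X \<subseteq> {..<n}"
    by (auto simp: X_def alg_allocation_def)
  have "i \<in> set (take e xs)" if "e \<noteq> 0" for e
    using that assms(1) xs(2) by (auto simp: i_def in_set_conv_nth intro!: exI[of _ 0])
  hence "(hard_instance n xs ! e) i = (if e = 0 then 1 else 0)" if "e \<in> X" for e
    using that X i by (subst hard_instance_nth) auto
  hence "valuation (hard_instance n xs) i X = (\<Sum>e\<in>X. if e = 0 then 1 else 0)"
    unfolding valuation_def by (intro sum.cong) auto
  also have "\<dots> \<le> 1"
    using finite_subset[OF X] by simp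
  finally show ?thesis
    using min_value_le[OF i] unfolding alg_value_def X_def by (rule order_trans[rotated])
qed

text \<open>For fixed \<open>\<omega>\<close> at most one summand is nonzero, by
  \<open>successful_permutation_unique\<close>. This pointwise bound is what gets integrated in the
  averaging argument.\<close>

lemma sum_alg_value_hard_instance_le_1:
  assumes "n \<ge> 1"
  shows "(\<Sum>xs\<in>permutations_of_set {1..n}. alg_value n alg (hard_instance n xs) \<omega>) \<le> 1"
proof -
  let ?f = "\<lambda>xs. alg_value n alg (hard_instance n xs) \<omega>"
  let ?P = "permutations_of_set {1..n}"
  show ?thesis
  proof (cases "\<exists>xs\<in>?P. ?f xs > 0")
    case True
    then obtain xs where xs: "xs \<in> ?P" "?f xs > 0"
      by blast
    have "?f ys = 0" if "ys \<in> ?P - {xs}" for ys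
      using that xs successful_permutation_unique[of xs n ys alg \<omega>]
        alg_value_nonneg[OF assms hard_instance_in_instances, of alg ys \<omega>]
      by (auto simp: less_le)
    hence "sum ?f ?P = ?f xs"
      using xs by (simp add: sum.remove)
    thus ?thesis
      using alg_value_hard_instance_le_1[OF assms xs(1)] by simp
  next
    case False
    hence "sum ?f ?P \<le> 0"
      by (intro sum_nonpos) (auto simp: not_less)
    thus ?thesis
      by simp
  qed
qed

lemma exists_hard_permutation:
  assumes "n \<ge> 1" "prob_space M"
  obtains xs where "xs \<in> permutations_of_set {1..n}"
    "(\<integral>\<omega>. alg_value n alg (hard_instance n xs) \<omega> \<partial>M) \<le> 1 / fact n"
proof -
  interpret prob_space M by fact
  let ?f = "\<lambda>xs \<omega>. alg_value n alg (hard_instance n xs) \<omega>"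
  let ?P = "permutations_of_set {1..n}"
  have "\<exists>xs\<in>?P. (\<integral>\<omega>. ?f xs \<omega> \<partial>M) \<le> 1 / fact n"
  \<comment> \<open>Integrability of all summands justifies exchanging sum and integral.\<close>
  proof (cases "\<forall>xs\<in>?P. integrable M (?f xs)")
    case True
    show ?thesis
    proof (rule ccontr)
      assume "\<not> ?thesis"
      \<comment> \<open>The left-hand side equals \<open>1\<close>, because \<open>?P\<close> has
        \<open>fact n\<close> elements; the contradiction is \<open>1 < 1\<close>.\<close>
      hence "(\<Sum>xs\<in>?P. 1 / fact n) < (\<Sum>xs\<in>?P. \<integral>\<omega>. ?f xs \<omega> \<partial>M)"
        by (intro sum_strict_mono) (auto simp: not_le permutations_of_set_empty_iff)
      also have "\<dots> = (\<integral>\<omega>. (\<Sum>xs\<in>?P. ?f xs \<omega>) \<partial>M)"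
        using True by (intro Bochner_Integration.integral_sum[symmetric]) auto
      also have "\<dots> \<le> 1"
        using True sum_alg_value_hard_instance_le_1[OF assms(1)]
        by (intro integral_le_const AE_I2 Bochner_Integration.integrable_sum) auto
      finally show False
        by simp
    qed
  next
    case False
    \<comment> \<open>The Bochner integral of a function that is not integrable is \<open>0\<close>.\<close>
    thus ?thesis
      by (auto simp: not_integrable_integral_eq intro!: bexI)
  qed
  thus ?thesis
    using that by blast
qed

theorem theorem8:
  fixes n :: nat and M :: "'w measure" and alg :: "'w algorithm"
  assumes "n \<ge> 1"
    and "randomized_online_algorithm n M alg"
  shows "strict_competitive_ratio n M alg \<le> 1 / fact n"
proof -
  have "prob_space M"
    using assms(2) by (simp add: randomized_online_algorithm_def)
  then obtain xs where xs: "xs \<in> permutations_of_set {1..n}"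
    and le: "(\<integral>\<omega>. alg_value n alg (hard_instance n xs) \<omega> \<partial>M) \<le> 1 / fact n"
    using exists_hard_permutation[OF assms(1)] by blast
  let ?E = "\<lambda>\<sigma>. \<integral>\<omega>. alg_value n alg \<sigma> \<omega> \<partial>M"
  let ?\<sigma> = "hard_instance n xs"
  have nonneg: "?E \<sigma> \<ge> 0" if "\<sigma> \<in> instances n" for \<sigma>
    using alg_value_nonneg[OF assms(1) that] by (intro Bochner_Integration.integral_nonneg)
  have opt: "opt n ?\<sigma> \<ge> 1"
    by (rule opt_hard_instance[OF assms(1) xs])
  have "strict_competitive_ratio n M alg \<le> ?E ?\<sigma> / opt n ?\<sigma>"
    \<comment> \<open>On the reals, bounding the infimum by one of its members requires the ratios
      to be bounded below; \<open>0\<close> serves as the bound.\<close>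
    unfolding strict_competitive_ratio_def
    using opt hard_instance_in_instances nonneg
    by (intro cINF_lower bdd_belowI[of _ 0]) (auto intro!: divide_nonneg_nonneg)
  also have "\<dots> \<le> ?E ?\<sigma> / 1"
    using opt nonneg[OF hard_instance_in_instances] by (intro divide_left_mono) auto
  finally show ?thesis
    using le by simp
qed

end
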